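(* The logic $\mathcal S'$ is algebraizable in the sense of Blok and Pigozzi with defining equation $\mathsf E(x)=\{x\approx 1\}$ and equivalence formulas $\Delta(x,y)=\{x\Rightarrow y,\ y\Rightarrow x\}$, and its equivalent algebraic semantics is the class of $\mathcal S'$-algebras.
   Context: $\mathcal S'$ is the sentential logic in the language $\langle\land,\lor,*,\Rightarrow,0,1\rangle$ of type $\langle2,2,2,2,0,0\rangle$ defined by the Hilbert-style calculus whose only rule is modus ponens (from $\varphi$ and $\varphi\Rightarrow\psi$ infer $\psi$) and whose axiom schemata are: (S1) $(\varphi\Rightarrow\psi)\Rightarrow((\psi\Rightarrow\gamma)\Rightarrow(\varphi\Rightarrow\gamma))$; (S2) $(\varphi\Rightarrow(\psi\Rightarrow\gamma))\Rightarrow(\psi\Rightarrow(\varphi\Rightarrow\gamma))$; (S3) $\varphi\Rightarrow(\psi\Rightarrow\varphi)$; (S4) $\varphi\Rightarrow(\psi\Rightarrow(\varphi*\psi))$; (S5) $(\varphi\Rightarrow(\psi\Rightarrow\gamma))\Rightarrow((\varphi*\psi)\Rightarrow\gamma)$; (S6) $(\varphi\land\psi)\Rightarrow\varphi$; (S7) $(\varphi\land\psi)\Rightarrow\psi$; (S8) $(\varphi\Rightarrow\psi)\Rightarrow((\varphi\Rightarrow\gamma)\Rightarrow(\varphi\Rightarrow(\psi\land\gamma)))$; (S9) $\varphi\Rightarrow(\varphi\lor\psi)$; (S10) $\psi\Rightarrow(\varphi\lor\psi)$; (S11) $(\varphi\Rightarrow\gamma)\Rightarrow((\psi\Rightarrow\gamma)\Rightarrow((\varphi\lor\psi)\Rightarrow\gamma))$;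 (S12) $1$; (S13) $0\Rightarrow\varphi$; (S14) $((\varphi\Rightarrow0)\Rightarrow0)\Rightarrow\varphi$; (S15) $(\varphi\Rightarrow(\varphi\Rightarrow(\varphi\Rightarrow\psi)))\Rightarrow(\varphi\Rightarrow(\varphi\Rightarrow\psi))$. A commutative integral residuated lattice (CIRL) is an algebra $\langle A,\land,\lor,*,\Rightarrow,1\rangle$ such that $\langle A,\land,\lor\rangle$ is a lattice with top element $1$, $\langle A,*,1\rangle$ is a commutative monoid, and $a*b\le c$ iff $b\le a\Rightarrow c$. A CIBRL is a CIRL with an extra constant $0$ that is the least element; set $\neg a:=a\Rightarrow0$. It is involutive if $\neg\neg x\approx x$, and three-potent if $a*a\le a*a*a$ for all $a$. An $\mathcal S'$-algebra is a three-potent involutive CIBRL. A logic $\vdash$ is algebraizable with defining equations $\mathsf E(x)$ and equivalence formulas $\Delta(x,y)$, with equivalent algebraic semantics a class $K$ of algebras, if for all sets of formulas $\Gamma\cup\{\varphi\}$: $\Gamma\vdash\varphi$ iff $\mathsf E(\Gamma)\models_K\mathsf E(\varphi)$, and $x\approx y$ and $\mathsf E(\Delta(x,y))$ are equationally interderivable over $K$ (here $\models_K$ is the equational consequence relation of $K$). *)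

theory Defs
  imports "HOL-Algebra.Group"
begin

section \<open>Formulas and the logic S'\<close>

datatype (vars: 'v) form =
    Var 'v
  | Conj "'v form" "'v form"  (infixr "\<^bold>\<and>" 55)
  | Disj "'v form" "'v form"  (infixr "\<^bold>\<or>" 50)
  | Fusion "'v form" "'v form"  (infixr "\<^bold>*" 60)
  | Imp "'v form" "'v form"  (infixr "\<^bold>\<Rightarrow>" 45)
  | Zero  ("\<^bold>0")
  | One  ("\<^bold>1")

text \<open>As usual for sentential logics, the set of variables is denumerable.\<close>

type_synonym fm = "nat form"

primrec subst :: "('v \<Rightarrow> 'w form) \<Rightarrow> 'v form \<Rightarrow> 'w form" where
  "subst s (Var x) = s x"
| "subst s (p \<^bold>\<and> q) = (subst s p \<^bold>\<and> subst s q)"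
| "subst s (p \<^bold>\<or> q) = (subst s p \<^bold>\<or> subst s q)"
| "subst s (p \<^bold>* q) = (subst s p \<^bold>* subst s q)"
| "subst s (p \<^bold>\<Rightarrow> q) = (subst s p \<^bold>\<Rightarrow> subst s q)"
| "subst s \<^bold>0 = \<^bold>0"
| "subst s \<^bold>1 = \<^bold>1"

inductive_set S'_axioms :: "fm set" where
  S1: "((p \<^bold>\<Rightarrow> q) \<^bold>\<Rightarrow> ((q \<^bold>\<Rightarrow> r) \<^bold>\<Rightarrow> (p \<^bold>\<Rightarrow> r))) \<in> S'_axioms"
| S2: "((p \<^bold>\<Rightarrow> (q \<^bold>\<Rightarrow> r)) \<^bold>\<Rightarrow> (q \<^bold>\<Rightarrow> (p \<^bold>\<Rightarrow> r))) \<in> S'_axioms"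
| S3: "(p \<^bold>\<Rightarrow> (q \<^bold>\<Rightarrow> p)) \<in> S'_axioms"
| S4: "(p \<^bold>\<Rightarrow> (q \<^bold>\<Rightarrow> (p \<^bold>* q))) \<in> S'_axioms"
| S5: "((p \<^bold>\<Rightarrow> (q \<^bold>\<Rightarrow> r)) \<^bold>\<Rightarrow> ((p \<^bold>* q) \<^bold>\<Rightarrow> r)) \<in> S'_axioms"
| S6: "((p \<^bold>\<and> q) \<^bold>\<Rightarrow> p) \<in> S'_axioms"
| S7: "((p \<^bold>\<and> q) \<^bold>\<Rightarrow> q) \<in> S'_axioms"
| S8: "((p \<^bold>\<Rightarrow> q) \<^bold>\<Rightarrow> ((p \<^bold>\<Rightarrow> r) \<^bold>\<Rightarrow> (p \<^bold>\<Rightarrow> (q \<^bold>\<and> r)))) \<in> S'_axioms"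
| S9: "(p \<^bold>\<Rightarrow> (p \<^bold>\<or> q)) \<in> S'_axioms"
| S10: "(q \<^bold>\<Rightarrow> (p \<^bold>\<or> q)) \<in> S'_axioms"
| S11: "((p \<^bold>\<Rightarrow> r) \<^bold>\<Rightarrow> ((q \<^bold>\<Rightarrow> r) \<^bold>\<Rightarrow> ((p \<^bold>\<or> q) \<^bold>\<Rightarrow> r))) \<in> S'_axioms"
| S12: "\<^bold>1 \<in> S'_axioms"
| S13: "(\<^bold>0 \<^bold>\<Rightarrow> p) \<in> S'_axioms"
| S14: "(((p \<^bold>\<Rightarrow> \<^bold>0) \<^bold>\<Rightarrow> \<^bold>0) \<^bold>\<Rightarrow> p) \<in> S'_axioms"
| S15: "((p \<^bold>\<Rightarrow> (p \<^bold>\<Rightarrow> (p \<^bold>\<Rightarrow> q))) \<^bold>\<Rightarrow> (p \<^bold>\<Rightarrow> (p \<^bold>\<Rightarrow> q))) \<in> S'_axioms"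

inductive S'_derives :: "fm set \<Rightarrow> fm \<Rightarrow> bool" for G :: "fm set" where
  premise: "p \<in> G \<Longrightarrow> S'_derives G p"
| axiom: "p \<in> S'_axioms \<Longrightarrow> S'_derives G p"
| modus_ponens: "S'_derives G p \<Longrightarrow> S'_derives G (p \<^bold>\<Rightarrow> q) \<Longrightarrow> S'_derives G q"


section \<open>Residuated lattices\<close>

text \<open>Algebras have an explicit carrier inside a type; the fields for the carrier, the
  product and the unit are those of HOL-Algebra monoids. The algebras here are equational
  ones, so the order is the derived relation \<^term>\<open>meet A x y = x\<close>.\<close>

record 'a cirl_algebra = "'a monoid" +
  meet :: "'a \<Rightarrow> 'a \<Rightarrow> 'a"  (infixl "\<curlywedge>\<index>" 70)
  join :: "'a \<Rightarrow> 'a \<Rightarrow> 'a"  (infixl "\<curlyvee>\<index>" 65)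
  resid :: "'a \<Rightarrow> 'a \<Rightarrow> 'a"  (infixr "\<rightarrow>\<index>" 55)

record 'a cibrl_algebra = "'a cirl_algebra" +
  zero :: 'a  ("\<zero>\<index>")

definition below :: "('a, 'b) cirl_algebra_scheme \<Rightarrow> 'a \<Rightarrow> 'a \<Rightarrow> bool"  (infix "\<preceq>\<index>" 50)
  where "x \<preceq>\<^bsub>A\<^esub> y \<longleftrightarrow> x \<curlywedge>\<^bsub>A\<^esub> y = x"

locale lattice_algebra =
  fixes A :: "('a, 'b) cirl_algebra_scheme" (structure)
  assumes meet_closed: "x \<in> carrier A \<Longrightarrow> y \<in> carrier A \<Longrightarrow> x \<curlywedge> y \<in> carrier A"
    and join_closed: "x \<in> carrier A \<Longrightarrow> y \<in> carrier A \<Longrightarrow> x \<curlyvee> y \<in> carrier A"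
    and meet_commute: "x \<in> carrier A \<Longrightarrow> y \<in> carrier A \<Longrightarrow> x \<curlywedge> y = y \<curlywedge> x"
    and join_commute: "x \<in> carrier A \<Longrightarrow> y \<in> carrier A \<Longrightarrow> x \<curlyvee> y = y \<curlyvee> x"
    and meet_assoc: "x \<in> carrier A \<Longrightarrow> y \<in> carrier A \<Longrightarrow> z \<in> carrier A \<Longrightarrow>
      (x \<curlywedge> y) \<curlywedge> z = x \<curlywedge> (y \<curlywedge> z)"
    and join_assoc: "x \<in> carrier A \<Longrightarrow> y \<in> carrier A \<Longrightarrow> z \<in> carrier A \<Longrightarrow>
      (x \<curlyvee> y) \<curlyvee> z = x \<curlyvee> (y \<curlyvee> z)"
    and meet_join_absorb: "x \<in> carrier A \<Longrightarrow> y \<in> carrier A \<Longrightarrow> x \<curlywedge> (x \<curlyvee> y) = x"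
    and join_meet_absorb: "x \<in> carrier A \<Longrightarrow> y \<in> carrier A \<Longrightarrow> x \<curlyvee> (x \<curlywedge> y) = x"

locale cirl = lattice_algebra A + comm_monoid A
  for A :: "('a, 'b) cirl_algebra_scheme" (structure) +
  assumes resid_closed: "x \<in> carrier A \<Longrightarrow> y \<in> carrier A \<Longrightarrow> x \<rightarrow> y \<in> carrier A"
    and one_top: "x \<in> carrier A \<Longrightarrow> x \<preceq> \<one>"
    and residuation: "x \<in> carrier A \<Longrightarrow> y \<in> carrier A \<Longrightarrow> z \<in> carrier A \<Longrightarrow>
      x \<otimes> y \<preceq> z \<longleftrightarrow> y \<preceq> x \<rightarrow> z"

locale cibrl = cirl A
  for A :: "('a, 'b) cibrl_algebra_scheme" (structure) +
  assumes zero_closed: "\<zero> \<in> carrier A"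
    and zero_least: "x \<in> carrier A \<Longrightarrow> \<zero> \<preceq> x"

definition neg :: "('a, 'b) cibrl_algebra_scheme \<Rightarrow> 'a \<Rightarrow> 'a"
  where "neg A x = x \<rightarrow>\<^bsub>A\<^esub> \<zero>\<^bsub>A\<^esub>"

locale S'_algebra = cibrl A
  for A :: "('a, 'b) cibrl_algebra_scheme" (structure) +
  assumes involutive: "x \<in> carrier A \<Longrightarrow> neg A (neg A x) = x"
    and three_potent: "x \<in> carrier A \<Longrightarrow> x \<otimes> x \<preceq> x \<otimes> x \<otimes> x"


section \<open>Equational consequence\<close>

text \<open>A pair of formulas stands for the equation between them.\<close>

type_synonym equation = "fm \<times> fm"

primrec eval :: "('a, 'b) cibrl_algebra_scheme \<Rightarrow> ('v \<Rightarrow> 'a) \<Rightarrow> 'v form \<Rightarrow> 'a" where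
  "eval A h (Var x) = h x"
| "eval A h (p \<^bold>\<and> q) = eval A h p \<curlywedge>\<^bsub>A\<^esub> eval A h q"
| "eval A h (p \<^bold>\<or> q) = eval A h p \<curlyvee>\<^bsub>A\<^esub> eval A h q"
| "eval A h (p \<^bold>* q) = eval A h p \<otimes>\<^bsub>A\<^esub> eval A h q"
| "eval A h (p \<^bold>\<Rightarrow> q) = eval A h p \<rightarrow>\<^bsub>A\<^esub> eval A h q"
| "eval A h \<^bold>0 = \<zero>\<^bsub>A\<^esub>"
| "eval A h \<^bold>1 = \<one>\<^bsub>A\<^esub>"

definition satisfies :: "'a cibrl_algebra \<Rightarrow> (nat \<Rightarrow> 'a) \<Rightarrow> equation \<Rightarrow> bool"
  where "satisfies A h e \<longleftrightarrow> eval A h (fst e) = eval A h (snd e)"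

definition eq_consequence ::
    "'a cibrl_algebra set \<Rightarrow> equation set \<Rightarrow> equation set \<Rightarrow> bool"
  where "eq_consequence K T U \<longleftrightarrow>
    (\<forall>A\<in>K. \<forall>h. range h \<subseteq> carrier A \<longrightarrow>
      (\<forall>e\<in>T. satisfies A h e) \<longrightarrow> (\<forall>e\<in>U. satisfies A h e))"


section \<open>Algebraizability\<close>

text \<open>Deductive systems in the sense of Blok and Pigozzi: finitary structural consequence
  relations.\<close>

definition deductive_system :: "(fm set \<Rightarrow> fm \<Rightarrow> bool) \<Rightarrow> bool"
  where "deductive_system L \<longleftrightarrow>
    (\<forall>G p. p \<in> G \<longrightarrow> L G p) \<and>
    (\<forall>G H p. L G p \<longrightarrow> (\<forall>q\<in>G. L H q) \<longrightarrow> L H p) \<and>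
    (\<forall>G p. L G p \<longrightarrow> (\<exists>F. finite F \<and> F \<subseteq> G \<and> L F p)) \<and>
    (\<forall>G p s. L G p \<longrightarrow> L (subst s ` G) (subst s p))"

text \<open>Defining equations are written in the variable \<^term>\<open>Var 0\<close>; \<open>E_inst E p\<close> is the
  instance \<open>E(p)\<close> and \<open>E_insts E G\<close> the union of the \<open>E(p)\<close> over all \<open>p\<close> in \<open>G\<close>.\<close>

definition E_inst :: "equation set \<Rightarrow> fm \<Rightarrow> equation set"
  where "E_inst E p = (\<lambda>(l, r). (subst (Var(0 := p)) l, subst (Var(0 := p)) r)) ` E"

definition E_insts :: "equation set \<Rightarrow> fm set \<Rightarrow> equation set"
  where "E_insts E G = (\<Union>p\<in>G. E_inst E p)"

text \<open>Equivalence formulas are written in \<^term>\<open>Var 0\<close> and \<^term>\<open>Var 1\<close>, so that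
  \<open>D\<close> itself is \<open>D(x, y)\<close> for distinct variables \<open>x\<close> and \<open>y\<close>.\<close>

definition algebraizable ::
    "(fm set \<Rightarrow> fm \<Rightarrow> bool) \<Rightarrow> equation set \<Rightarrow> fm set \<Rightarrow> 'a cibrl_algebra set \<Rightarrow> bool"
  where "algebraizable L E D K \<longleftrightarrow>
    deductive_system L \<and>
    finite E \<and> (\<forall>(l, r)\<in>E. vars l \<union> vars r \<subseteq> {0}) \<and>
    finite D \<and> (\<forall>d\<in>D. vars d \<subseteq> {0, 1}) \<and>
    (\<forall>G p. L G p \<longleftrightarrow> eq_consequence K (E_insts E G) (E_inst E p)) \<and>
    eq_consequence K {(Var 0, Var 1)} (E_insts E D) \<and>
    eq_consequence K (E_insts E D) {(Var 0, Var 1)}"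

text \<open>A class of algebras cannot range over all types at once, so it is given by its members
  with carrier inside a type \<open>'a\<close>. To capture the whole class, algebraizability is to be
  claimed for every infinite \<open>'a\<close>: every algebra is isomorphic to one with carrier inside
  some infinite type. (For finite \<open>'a\<close> the class would contain only algebras of bounded
  size.)\<close>

definition S'_algebras :: "'a cibrl_algebra set"
  where "S'_algebras = {A. S'_algebra A}"

end

theory Submission
  imports Defs "HOL-Library.Countable"
begin

text \<open>Soundness amounts to checking that in every algebra \<open>x \<rightarrow> y = \<one>\<close> holds exactly when
  \<open>x \<preceq> y\<close>, which turns each axiom into an inequation provable by residuation. For completeness,
  given premises \<open>G\<close>, the Lindenbaum algebra of formulas modulo provable equivalence from \<open>G\<close> is
  countable, hence can be transported into any infinite type; under the canonical valuation the
  formulas with value \<open>\<one>\<close> are exactly the consequences of \<open>G\<close>.\<close>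

section \<open>Order and residuation in the algebras\<close>

context lattice_algebra
begin

text \<open>Meeting \<open>x\<close> with \<open>x \<curlyvee> (x \<curlywedge> x)\<close> gives
  \<open>x\<close> by one absorption law and \<open>x \<curlywedge> x\<close> by the other.\<close>

lemma meet_idem: "x \<in> carrier A \<Longrightarrow> x \<curlywedge> x = x"
  by (metis meet_closed meet_join_absorb join_meet_absorb)

lemma below_refl: "x \<in> carrier A \<Longrightarrow> x \<preceq> x"
  by (simp add: below_def meet_idem)

lemma below_antisym:
  "x \<in> carrier A \<Longrightarrow> y \<in> carrier A \<Longrightarrow> x \<preceq> y \<Longrightarrow> y \<preceq> x \<Longrightarrow> x = y"
  by (metis below_def meet_commute)

lemma below_trans:
  "x \<in> carrier A \<Longrightarrow> y \<in> carrier A \<Longrightarrow> z \<in> carrier A \<Longrightarrow> x \<preceq> y \<Longrightarrow> y \<preceq> z \<Longrightarrow> x \<preceq> z"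
  by (metis below_def meet_assoc)

lemma meet_below1: "x \<in> carrier A \<Longrightarrow> y \<in> carrier A \<Longrightarrow> x \<curlywedge> y \<preceq> x"
  by (metis below_def meet_assoc meet_commute meet_idem)

lemma meet_below2: "x \<in> carrier A \<Longrightarrow> y \<in> carrier A \<Longrightarrow> x \<curlywedge> y \<preceq> y"
  by (simp add: below_def meet_assoc meet_idem)

lemma below_meetI:
  "x \<in> carrier A \<Longrightarrow> y \<in> carrier A \<Longrightarrow> z \<in> carrier A \<Longrightarrow> z \<preceq> x \<Longrightarrow> z \<preceq> y \<Longrightarrow> z \<preceq> x \<curlywedge> y"
  by (metis below_def meet_assoc)

lemma below_iff_join: "x \<in> carrier A \<Longrightarrow> y \<in> carrier A \<Longrightarrow> x \<preceq> y \<longleftrightarrow> x \<curlyvee> y = y"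
  by (metis below_def join_commute join_meet_absorb meet_commute meet_join_absorb)

lemma below_join1: "x \<in> carrier A \<Longrightarrow> y \<in> carrier A \<Longrightarrow> x \<preceq> x \<curlyvee> y"
  by (simp add: below_def meet_join_absorb)

lemma below_join2: "x \<in> carrier A \<Longrightarrow> y \<in> carrier A \<Longrightarrow> y \<preceq> x \<curlyvee> y"
  by (metis below_join1 join_commute)

lemma join_belowI:
  "x \<in> carrier A \<Longrightarrow> y \<in> carrier A \<Longrightarrow> z \<in> carrier A \<Longrightarrow> x \<preceq> z \<Longrightarrow> y \<preceq> z \<Longrightarrow> x \<curlyvee> y \<preceq> z"
  by (simp add: below_iff_join join_assoc join_closed)

end

section \<open>Residuation laws and the inequations behind the axioms\<close>

context cirl
begin

lemma one_below_iff: "x \<in> carrier A \<Longrightarrow> \<one> \<preceq> x \<longleftrightarrow> x = \<one>"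
  using below_antisym below_refl one_top by blast

text \<open>Residuation with \<open>\<one>\<close> as second factor turns
  \<open>x \<preceq> y\<close> into \<open>\<one> \<preceq> x \<rightarrow> y\<close>, and the top
  element lies below nothing but itself.\<close>

lemma resid_eq_one_iff:
  "x \<in> carrier A \<Longrightarrow> y \<in> carrier A \<Longrightarrow> x \<rightarrow> y = \<one> \<longleftrightarrow> x \<preceq> y"
  using residuation[of x \<one> y] by (simp add: one_below_iff resid_closed)

lemma mult_resid_below: "x \<in> carrier A \<Longrightarrow> y \<in> carrier A \<Longrightarrow> x \<otimes> (x \<rightarrow> y) \<preceq> y"
  by (simp add: residuation resid_closed below_refl)

text \<open>Monotonicity is derived: residuating
  \<open>x \<otimes> z \<preceq> x \<otimes> z\<close> puts \<open>z\<close>, hence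
  \<open>y\<close>, below \<open>x \<rightarrow> x \<otimes> z\<close>.\<close>

lemma mult_mono_right:
  assumes "x \<in> carrier A" "y \<in> carrier A" "z \<in> carrier A" "y \<preceq> z"
  shows "x \<otimes> y \<preceq> x \<otimes> z"
proof -
  have "z \<preceq> x \<rightarrow> x \<otimes> z"
    using residuation[of x z "x \<otimes> z"] assms below_refl by simp
  then have "y \<preceq> x \<rightarrow> x \<otimes> z"
    using below_trans[of y z "x \<rightarrow> x \<otimes> z"] assms resid_closed by simp
  then show ?thesis
    using residuation assms by simp
qed

lemma mult_mono_left:
  "x \<in> carrier A \<Longrightarrow> y \<in> carrier A \<Longrightarrow> z \<in> carrier A \<Longrightarrow> y \<preceq> z \<Longrightarrow> y \<otimes> x \<preceq> z \<otimes> x"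
  using mult_mono_right by (simp add: m_comm)

text \<open>Integrality: since \<open>x \<preceq> \<one>\<close>, multiplying by \<open>x\<close>
  can only decrease.\<close>

lemma mult_below_right: "x \<in> carrier A \<Longrightarrow> y \<in> carrier A \<Longrightarrow> x \<otimes> y \<preceq> y"
  using mult_mono_left[of y x \<one>] one_top by simp

text \<open>Axiom S1. Residuation reduces it to two successive uses of
  \<open>mult_resid_below\<close>, first for \<open>x \<rightarrow> y\<close>, then for
  \<open>y \<rightarrow> z\<close>.\<close>

lemma prefixing_valid:
  assumes [simp]: "x \<in> carrier A" "y \<in> carrier A" "z \<in> carrier A"
  shows "x \<rightarrow> y \<preceq> (y \<rightarrow> z) \<rightarrow> (x \<rightarrow> z)"
proof -
  note [simp] = resid_closed
  have "(x \<otimes> (x \<rightarrow> y)) \<otimes> (y \<rightarrow> z) \<preceq> y \<otimes> (y \<rightarrow> z)"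
    by (intro mult_mono_left mult_resid_below) simp_all
  then have "(x \<otimes> (x \<rightarrow> y)) \<otimes> (y \<rightarrow> z) \<preceq> z"
    by (rule below_trans[rotated 3, OF _ mult_resid_below]) simp_all
  then show ?thesis
    by (simp add: residuation[symmetric] m_ac)
qed

text \<open>Common core of S2 and S5, which become this inequation after residuation and a
  rearrangement of factors.\<close>

lemma mult_mult_resid_below:
  assumes [simp]: "x \<in> carrier A" "y \<in> carrier A" "z \<in> carrier A"
  shows "y \<otimes> (x \<otimes> (x \<rightarrow> (y \<rightarrow> z))) \<preceq> z"
  by (simp add: residuation resid_closed below_refl)

lemma exchange_valid:
  assumes [simp]: "x \<in> carrier A" "y \<in> carrier A" "z \<in> carrier A"
  shows "x \<rightarrow> (y \<rightarrow> z) \<preceq> y \<rightarrow> (x \<rightarrow> z)"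
  using mult_mult_resid_below[of x y z] resid_closed
  by (simp add: residuation[symmetric] m_ac)

lemma fusion_elim_valid:
  assumes [simp]: "x \<in> carrier A" "y \<in> carrier A" "z \<in> carrier A"
  shows "x \<rightarrow> (y \<rightarrow> z) \<preceq> x \<otimes> y \<rightarrow> z"
  using mult_mult_resid_below[of x y z] resid_closed
  by (simp add: residuation[symmetric] m_ac)

text \<open>Integrality discards the factor \<open>z\<close>. S8 and S11 each produce the extra
  factor on both sides of the residual.\<close>

lemma mult_resids_below:
  assumes [simp]: "x \<in> carrier A" "y \<in> carrier A" "z \<in> carrier A"
  shows "x \<otimes> (z \<otimes> (x \<rightarrow> y)) \<preceq> y" "x \<otimes> ((x \<rightarrow> y) \<otimes> z) \<preceq> y"
proof -
  show *: "x \<otimes> (z \<otimes> (x \<rightarrow> y)) \<preceq> y"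
    by (subst residuation) (simp_all add: resid_closed mult_below_right)
  then show "x \<otimes> ((x \<rightarrow> y) \<otimes> z) \<preceq> y"
    by (simp add: m_comm resid_closed)
qed

lemma meet_intro_valid:
  assumes [simp]: "x \<in> carrier A" "y \<in> carrier A" "z \<in> carrier A"
  shows "x \<rightarrow> y \<preceq> (x \<rightarrow> z) \<rightarrow> (x \<rightarrow> y \<curlywedge> z)"
  by (simp add: residuation[symmetric] resid_closed meet_closed below_meetI mult_resids_below)

lemma join_elim_valid:
  assumes [simp]: "x \<in> carrier A" "y \<in> carrier A" "z \<in> carrier A"
  shows "x \<rightarrow> z \<preceq> (y \<rightarrow> z) \<rightarrow> (x \<curlyvee> y \<rightarrow> z)"
proof -
  note [simp] = resid_closed join_closed
  \<comment> \<open>With both residuals gathered in one factor, \<open>?w \<rightarrow> z\<close>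
    bounds \<open>x\<close> and \<open>y\<close> from above, so fusion need not be distributed over
    the join.\<close>
  let ?w = "(y \<rightarrow> z) \<otimes> (x \<rightarrow> z)"
  have "x \<preceq> ?w \<rightarrow> z" "y \<preceq> ?w \<rightarrow> z"
    using mult_resids_below(1)[of x z "y \<rightarrow> z"] mult_resids_below(2)[of y z "x \<rightarrow> z"]
    by (simp_all add: residuation[symmetric] m_comm)
  then have "x \<curlyvee> y \<preceq> ?w \<rightarrow> z"
    by (simp add: join_belowI)
  then have "?w \<otimes> (x \<curlyvee> y) \<preceq> z"
    by (simp add: residuation)
  then show ?thesis
    by (simp add: residuation[symmetric] m_comm)
qed

end

text \<open>Axiom S15. Three-potency replaces the square of \<open>x\<close> by its cube, which
  cancels the three nested residuals.\<close>

lemma (in S'_algebra) contraction_valid: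
  assumes [simp]: "x \<in> carrier A" "y \<in> carrier A"
  shows "x \<rightarrow> (x \<rightarrow> (x \<rightarrow> y)) \<preceq> x \<rightarrow> (x \<rightarrow> y)"
proof -
  note [simp] = resid_closed
  let ?w = "x \<rightarrow> (x \<rightarrow> (x \<rightarrow> y))"
  have "(x \<otimes> x) \<otimes> ?w \<preceq> (x \<otimes> x \<otimes> x) \<otimes> ?w"
    by (intro mult_mono_left three_potent) simp_all
  moreover have "(x \<otimes> x \<otimes> x) \<otimes> ?w \<preceq> y"
    by (simp add: m_assoc residuation below_refl)
  ultimately have "(x \<otimes> x) \<otimes> ?w \<preceq> y"
    by (rule below_trans[rotated 3]) simp_all
  then show ?thesis
    by (simp add: m_assoc residuation[symmetric])
qed

lemma (in S'_algebra) eq_iff_resids_eq_one: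
  "x \<in> carrier A \<Longrightarrow> y \<in> carrier A \<Longrightarrow> x = y \<longleftrightarrow> x \<rightarrow> y = \<one> \<and> y \<rightarrow> x = \<one>"
  by (auto simp: resid_eq_one_iff below_refl intro: below_antisym)


section \<open>Soundness\<close>

context S'_algebra
begin

lemma eval_closed: "range h \<subseteq> carrier A \<Longrightarrow> eval A h p \<in> carrier A"
  by (induction p)
    (auto simp: meet_closed join_closed resid_closed zero_closed)

lemma eval_axiom:
  assumes "p \<in> S'_axioms" and h: "range h \<subseteq> carrier A"
  shows "eval A h p = \<one>"
proof -
  note [simp] = eval_closed[OF h] meet_closed join_closed resid_closed zero_closed resid_eq_one_iff
  \<comment> \<open>Involutivity with \<open>neg\<close> unfolded, the shape in which S14
    evaluates.\<close>
  have [simp]: "(x \<rightarrow> \<zero>) \<rightarrow> \<zero> = x" if "x \<in> carrier A" for x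
    using involutive[OF that] by (simp add: neg_def)
  show ?thesis
    using assms(1)
  proof cases
    \<comment> \<open>S3 and S4 match no inequation proved above until one more residuation moves
      the inner antecedent to the left.\<close>
    case (S3 q r)
    then show ?thesis
      by (simp add: residuation[symmetric] mult_below_right)
  next
    case (S4 q r)
    then show ?thesis
      by (simp add: residuation[symmetric] m_comm below_refl)
  qed (simp_all add: prefixing_valid exchange_valid fusion_elim_valid meet_below1 meet_below2
      meet_intro_valid below_join1 below_join2 join_elim_valid zero_least below_refl
      contraction_valid)
qed

lemma soundness:
  assumes "S'_derives G p" and h: "range h \<subseteq> carrier A"
    and "\<And>q. q \<in> G \<Longrightarrow> eval A h q = \<one>"
  shows "eval A h p = \<one>"
  using assms(1)
proof induction
  case (modus_ponens p q)
  then have "\<one> \<rightarrow> eval A h q = \<one>"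
    by simp
  then show ?case
    using eval_closed[OF h] by (simp add: resid_eq_one_iff one_below_iff)
qed (use assms eval_axiom in auto)

end


section \<open>The deductive system\<close>

lemma S'_axioms_subst: "p \<in> S'_axioms \<Longrightarrow> subst s p \<in> S'_axioms"
  by (induction rule: S'_axioms.induct) (simp_all add: S'_axioms.intros)

lemma S'_derives_subst: "S'_derives G p \<Longrightarrow> S'_derives (subst s ` G) (subst s p)"
proof (induction rule: S'_derives.induct)
  case (modus_ponens p q)
  then show ?case
    by (auto intro: S'_derives.modus_ponens)
qed (auto intro: S'_derives.premise S'_derives.axiom S'_axioms_subst)

lemma S'_derives_cut: "S'_derives G p \<Longrightarrow> (\<And>q. q \<in> G \<Longrightarrow> S'_derives H q) \<Longrightarrow> S'_derives H p"
  by (induction rule: S'_derives.induct) (auto intro: S'_derives.intros)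

lemma S'_derives_mono: "S'_derives G p \<Longrightarrow> G \<subseteq> H \<Longrightarrow> S'_derives H p"
  by (auto intro: S'_derives_cut S'_derives.premise)

lemma S'_derives_finitary: "S'_derives G p \<Longrightarrow> \<exists>F. finite F \<and> F \<subseteq> G \<and> S'_derives F p"
proof (induction rule: S'_derives.induct)
  case (premise p)
  then show ?case
    by (intro exI[of _ "{p}"]) (auto intro: S'_derives.premise)
next
  case (axiom p)
  then show ?case
    by (intro exI[of _ "{}"]) (auto intro: S'_derives.axiom)
next
  case (modus_ponens p q)
  then obtain E F where "finite E" "E \<subseteq> G" "S'_derives E p"
    and "finite F" "F \<subseteq> G" "S'_derives F (p \<^bold>\<Rightarrow> q)"
    by blast
  then show ?case
    by (intro exI[of _ "E \<union> F"])
      (auto intro: S'_derives.modus_ponens[of _ p] S'_derives_mono)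
qed

lemma deductive_system_S'_derives: "deductive_system S'_derives"
  unfolding deductive_system_def
proof (intro conjI allI impI)
  show "S'_derives H p" if "S'_derives G p" "\<forall>q\<in>G. S'_derives H q" for G H p
    using that by (auto intro: S'_derives_cut)
qed (simp_all add: S'_derives.premise S'_derives_finitary S'_derives_subst)


section \<open>The Lindenbaum algebra\<close>

definition entails :: "fm set \<Rightarrow> fm \<Rightarrow> fm \<Rightarrow> bool"
  where "entails G p q \<longleftrightarrow> S'_derives G (p \<^bold>\<Rightarrow> q)"

definition equivalent :: "fm set \<Rightarrow> fm \<Rightarrow> fm \<Rightarrow> bool"
  where "equivalent G p q \<longleftrightarrow> entails G p q \<and> entails G q p"

lemma entails_axiom: "(p \<^bold>\<Rightarrow> q) \<in> S'_axioms \<Longrightarrow> entails G p q"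
  by (simp add: entails_def S'_derives.axiom)

lemma entails_mp: "entails G p q \<Longrightarrow> S'_derives G p \<Longrightarrow> S'_derives G q"
  unfolding entails_def by (rule S'_derives.modus_ponens)

text \<open>Turns an axiom whose two sides are implications into a rule about
  \<open>entails\<close>.\<close>

lemma entails_impD: "entails G (p \<^bold>\<Rightarrow> q) (r \<^bold>\<Rightarrow> s) \<Longrightarrow> entails G p q \<Longrightarrow> entails G r s"
  unfolding entails_def by (rule S'_derives.modus_ponens)

lemma entails_trans: "entails G p q \<Longrightarrow> entails G q r \<Longrightarrow> entails G p r"
  using entails_impD[OF entails_impD[OF entails_axiom[OF S1]]] .

lemma entails_exchange: "entails G p (q \<^bold>\<Rightarrow> r) \<Longrightarrow> entails G q (p \<^bold>\<Rightarrow> r)"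
  using entails_impD[OF entails_axiom[OF S2]] .

lemma entails_of_derives: "S'_derives G q \<Longrightarrow> entails G p q"
  using entails_mp[OF entails_axiom[OF S3]] by (simp add: entails_def)

lemma derives_iff_entails_one: "S'_derives G p \<longleftrightarrow> entails G \<^bold>1 p"
  by (auto intro: entails_of_derives entails_mp S'_derives.axiom S12)

text \<open>Exchanging the antecedents of S3 yields \<open>q\<close> implies (\<open>p\<close>
  implies \<open>p\<close>); the theorem S12 is taken for \<open>q\<close>.\<close>

lemma entails_refl: "entails G p p"
  using entails_mp[OF entails_exchange[OF entails_axiom[OF S3]] S'_derives.axiom[OF S12]]
  by (simp add: entails_def)

lemma entails_fusion_iff: "entails G (p \<^bold>* q) r \<longleftrightarrow> entails G p (q \<^bold>\<Rightarrow> r)"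
proof
  assume "entails G (p \<^bold>* q) r"
  \<comment> \<open>S1 with its antecedents exchanged is monotonicity of implication in the
    consequent.\<close>
  then have "entails G (q \<^bold>\<Rightarrow> p \<^bold>* q) (q \<^bold>\<Rightarrow> r)"
    by (rule entails_impD[OF entails_exchange[OF entails_axiom[OF S1]]])
  then show "entails G p (q \<^bold>\<Rightarrow> r)"
    by (rule entails_trans[OF entails_axiom[OF S4]])
next
  assume "entails G p (q \<^bold>\<Rightarrow> r)"
  then show "entails G (p \<^bold>* q) r"
    by (rule entails_impD[OF entails_axiom[OF S5]])
qed

lemma entails_conj_iff: "entails G r (p \<^bold>\<and> q) \<longleftrightarrow> entails G r p \<and> entails G r q"
  by (meson entails_impD[OF entails_impD[OF entails_axiom[OF S8]]]
      entails_trans[OF _ entails_axiom[OF S6]] entails_trans[OF _ entails_axiom[OF S7]])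

lemma entails_disj_iff: "entails G (p \<^bold>\<or> q) r \<longleftrightarrow> entails G p r \<and> entails G q r"
  by (meson entails_impD[OF entails_impD[OF entails_axiom[OF S11]]]
      entails_trans[OF entails_axiom[OF S9]] entails_trans[OF entails_axiom[OF S10]])

lemma entails_exchange_iff: "entails G p (q \<^bold>\<Rightarrow> r) \<longleftrightarrow> entails G q (p \<^bold>\<Rightarrow> r)"
  by (rule iffI; rule entails_exchange)

lemma entails_fusion_iff': "entails G (p \<^bold>* q) r \<longleftrightarrow> entails G q (p \<^bold>\<Rightarrow> r)"
  by (rule entails_fusion_iff[THEN trans, OF entails_exchange_iff])

text \<open>A Yoneda argument: instantiate \<open>r\<close> with \<open>p\<close> and with
  \<open>q\<close>. Equivalences can thus be read off from the adjunction laws for the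
  connectives.\<close>

lemma equivalentI_left: "(\<And>r. entails G r p \<longleftrightarrow> entails G r q) \<Longrightarrow> equivalent G p q"
  unfolding equivalent_def using entails_refl by blast

lemma equivalentI_right: "(\<And>r. entails G p r \<longleftrightarrow> entails G q r) \<Longrightarrow> equivalent G p q"
  unfolding equivalent_def using entails_refl by blast

lemma equivalent_entails_iff:
  "equivalent G p q \<Longrightarrow> entails G p r \<longleftrightarrow> entails G q r"
  "equivalent G p q \<Longrightarrow> entails G r p \<longleftrightarrow> entails G r q"
  unfolding equivalent_def using entails_trans by blast+

text \<open>Each connective is characterised by what entails it or what it entails. For fusion and
  implication, residuation and exchange expose one argument at a time as a side of
  \<open>entails\<close>, where it can be replaced.\<close>

lemma equivalent_cong:
  assumes "equivalent G p p'" "equivalent G q q'"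
  shows "equivalent G (p \<^bold>\<and> q) (p' \<^bold>\<and> q')" "equivalent G (p \<^bold>\<or> q) (p' \<^bold>\<or> q')"
    "equivalent G (p \<^bold>* q) (p' \<^bold>* q')" "equivalent G (p \<^bold>\<Rightarrow> q) (p' \<^bold>\<Rightarrow> q')"
proof -
  note [simp] = assms[THEN equivalent_entails_iff(1)] assms[THEN equivalent_entails_iff(2)]
  show "equivalent G (p \<^bold>\<and> q) (p' \<^bold>\<and> q')"
    by (rule equivalentI_left) (simp add: entails_conj_iff)
  show "equivalent G (p \<^bold>\<or> q) (p' \<^bold>\<or> q')"
    by (rule equivalentI_right) (simp add: entails_disj_iff)
  have "entails G (p \<^bold>* q) r \<longleftrightarrow> entails G (p' \<^bold>* q') r" for r
  proof -
    have "entails G (p \<^bold>* q) r \<longleftrightarrow> entails G p' (q \<^bold>\<Rightarrow> r)"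
      by (simp add: entails_fusion_iff)
    also have "\<dots> \<longleftrightarrow> entails G q' (p' \<^bold>\<Rightarrow> r)"
      by (subst entails_exchange_iff) simp
    finally show ?thesis
      by (simp add: entails_fusion_iff')
  qed
  then show "equivalent G (p \<^bold>* q) (p' \<^bold>* q')"
    by (rule equivalentI_right)
  have "entails G r (p \<^bold>\<Rightarrow> q) \<longleftrightarrow> entails G r (p' \<^bold>\<Rightarrow> q')" for r
  proof -
    have "entails G r (p \<^bold>\<Rightarrow> q) \<longleftrightarrow> entails G p' (r \<^bold>\<Rightarrow> q)"
      by (subst entails_exchange_iff) simp
    also have "\<dots> \<longleftrightarrow> entails G (p' \<^bold>* r) q'"
      by (simp add: entails_fusion_iff[symmetric])
    finally show ?thesis
      by (simp add: entails_fusion_iff')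
  qed
  then show "equivalent G (p \<^bold>\<Rightarrow> q) (p' \<^bold>\<Rightarrow> q')"
    by (rule equivalentI_left)
qed

lemma entails_fusion_one: "entails G (\<^bold>1 \<^bold>* p) r \<longleftrightarrow> entails G p r"
  unfolding entails_fusion_iff derives_iff_entails_one[symmetric] by (simp add: entails_def)

lemma entails_fusion_commute: "entails G (p \<^bold>* q) r \<longleftrightarrow> entails G (q \<^bold>* p) r"
  using entails_fusion_iff entails_fusion_iff' by blast

text \<open>Residuating both bracketings down to \<open>q\<close> leaves consequents that differ
  only by an exchange of \<open>p\<close> and \<open>r\<close>.\<close>

lemma entails_fusion_assoc: "entails G ((p \<^bold>* q) \<^bold>* r) s \<longleftrightarrow> entails G (p \<^bold>* (q \<^bold>* r)) s"
proof -
  have "equivalent G (p \<^bold>\<Rightarrow> r \<^bold>\<Rightarrow> s) (r \<^bold>\<Rightarrow> p \<^bold>\<Rightarrow> s)"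
    by (simp add: equivalent_def entails_axiom S2)
  then have "entails G q (p \<^bold>\<Rightarrow> r \<^bold>\<Rightarrow> s) \<longleftrightarrow> entails G q (r \<^bold>\<Rightarrow> p \<^bold>\<Rightarrow> s)"
    by (rule equivalent_entails_iff)
  then show ?thesis
    by (metis entails_fusion_iff entails_fusion_iff')
qed

text \<open>The function \<open>c\<close> names the equivalence class of a formula by an element of \<open>'a\<close>;
  the operations act on arbitrary representatives.\<close>

definition lindenbaum :: "(fm \<Rightarrow> 'a) \<Rightarrow> 'a cibrl_algebra" where
  "lindenbaum c = \<lparr>carrier = range c,
    mult = (\<lambda>x y. c (inv_into UNIV c x \<^bold>* inv_into UNIV c y)), one = c \<^bold>1,
    meet = (\<lambda>x y. c (inv_into UNIV c x \<^bold>\<and> inv_into UNIV c y)),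
    join = (\<lambda>x y. c (inv_into UNIV c x \<^bold>\<or> inv_into UNIV c y)),
    resid = (\<lambda>x y. c (inv_into UNIV c x \<^bold>\<Rightarrow> inv_into UNIV c y)), zero = c \<^bold>0\<rparr>"

text \<open>Plays the role of the quotient map. Taking values in \<open>'a\<close> rather than in
  sets of formulas keeps the quotient inside the prescribed type.\<close>

locale class_naming =
  fixes G :: "fm set" and c :: "fm \<Rightarrow> 'a"
  assumes naming_eq_iff: "c p = c q \<longleftrightarrow> equivalent G p q"
begin

lemma equivalent_inv_naming: "equivalent G (inv_into UNIV c (c p)) p"
  using naming_eq_iff f_inv_into_f[of "c p" c UNIV] by blast

text \<open>Well-definedness: the chosen representatives are equivalent to \<open>p\<close> and
  \<open>q\<close>, and the congruence laws absorb the choice.\<close>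

lemma lindenbaum_simps [simp]:
  "carrier (lindenbaum c) = range c"
  "c p \<otimes>\<^bsub>lindenbaum c\<^esub> c q = c (p \<^bold>* q)"
  "c p \<curlywedge>\<^bsub>lindenbaum c\<^esub> c q = c (p \<^bold>\<and> q)"
  "c p \<curlyvee>\<^bsub>lindenbaum c\<^esub> c q = c (p \<^bold>\<or> q)"
  "c p \<rightarrow>\<^bsub>lindenbaum c\<^esub> c q = c (p \<^bold>\<Rightarrow> q)"
  "\<one>\<^bsub>lindenbaum c\<^esub> = c \<^bold>1"
  "\<zero>\<^bsub>lindenbaum c\<^esub> = c \<^bold>0"
  by (simp_all add: lindenbaum_def naming_eq_iff equivalent_cong equivalent_inv_naming)

lemma below_lindenbaum_iff [simp]: "c p \<preceq>\<^bsub>lindenbaum c\<^esub> c q \<longleftrightarrow> entails G p q"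
  by (simp add: below_def naming_eq_iff equivalent_def entails_conj_iff entails_refl
      entails_axiom[OF S6])

lemma naming_eqI_left: "(\<And>r. entails G r p \<longleftrightarrow> entails G r q) \<Longrightarrow> c p = c q"
  by (simp add: naming_eq_iff equivalentI_left)

lemma naming_eqI_right: "(\<And>r. entails G p r \<longleftrightarrow> entails G q r) \<Longrightarrow> c p = c q"
  by (simp add: naming_eq_iff equivalentI_right)

lemma lindenbaum_lattice: "lattice_algebra (lindenbaum c)"
proof
  fix x y z
  assume "x \<in> carrier (lindenbaum c)" "y \<in> carrier (lindenbaum c)"
  then obtain p q where [simp]: "x = c p" "y = c q"
    by auto
  show "x \<curlywedge>\<^bsub>lindenbaum c\<^esub> y \<in> carrier (lindenbaum c)"
    "x \<curlyvee>\<^bsub>lindenbaum c\<^esub> y \<in> carrier (lindenbaum c)"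
    by simp_all
  show "x \<curlywedge>\<^bsub>lindenbaum c\<^esub> y = y \<curlywedge>\<^bsub>lindenbaum c\<^esub> x"
    "x \<curlywedge>\<^bsub>lindenbaum c\<^esub> (x \<curlyvee>\<^bsub>lindenbaum c\<^esub> y) = x"
    using entails_trans[OF _ entails_axiom[OF S9]]
    by (auto intro!: naming_eqI_left simp: entails_conj_iff)
  show "x \<curlyvee>\<^bsub>lindenbaum c\<^esub> y = y \<curlyvee>\<^bsub>lindenbaum c\<^esub> x"
    "x \<curlyvee>\<^bsub>lindenbaum c\<^esub> (x \<curlywedge>\<^bsub>lindenbaum c\<^esub> y) = x"
    using entails_trans[OF entails_axiom[OF S6]]
    by (auto intro!: naming_eqI_right simp: entails_disj_iff)
  assume "z \<in> carrier (lindenbaum c)"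
  then obtain r where [simp]: "z = c r"
    by auto
  show "x \<curlywedge>\<^bsub>lindenbaum c\<^esub> y \<curlywedge>\<^bsub>lindenbaum c\<^esub> z = x \<curlywedge>\<^bsub>lindenbaum c\<^esub> (y \<curlywedge>\<^bsub>lindenbaum c\<^esub> z)"
    by (auto intro!: naming_eqI_left simp: entails_conj_iff)
  show "x \<curlyvee>\<^bsub>lindenbaum c\<^esub> y \<curlyvee>\<^bsub>lindenbaum c\<^esub> z = x \<curlyvee>\<^bsub>lindenbaum c\<^esub> (y \<curlyvee>\<^bsub>lindenbaum c\<^esub> z)"
    by (auto intro!: naming_eqI_right simp: entails_disj_iff)
qed

lemma lindenbaum_comm_monoid: "comm_monoid (lindenbaum c)"
proof (rule comm_monoidI)
  fix x y
  assume "x \<in> carrier (lindenbaum c)" "y \<in> carrier (lindenbaum c)"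
  then show "x \<otimes>\<^bsub>lindenbaum c\<^esub> y = y \<otimes>\<^bsub>lindenbaum c\<^esub> x"
    by (auto intro!: naming_eqI_right simp: entails_fusion_commute)
next
  fix x y z
  assume "x \<in> carrier (lindenbaum c)" "y \<in> carrier (lindenbaum c)" "z \<in> carrier (lindenbaum c)"
  then show "x \<otimes>\<^bsub>lindenbaum c\<^esub> y \<otimes>\<^bsub>lindenbaum c\<^esub> z = x \<otimes>\<^bsub>lindenbaum c\<^esub> (y \<otimes>\<^bsub>lindenbaum c\<^esub> z)"
    by (auto intro!: naming_eqI_right simp: entails_fusion_assoc)
qed (auto intro!: naming_eqI_right simp: entails_fusion_one)

lemma lindenbaum_S'_algebra: "S'_algebra (lindenbaum c)"
proof -
  interpret lattice_algebra "lindenbaum c"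
    by (rule lindenbaum_lattice)
  interpret comm_monoid "lindenbaum c"
    by (rule lindenbaum_comm_monoid)
  show ?thesis
  proof
    fix x
    assume "x \<in> carrier (lindenbaum c)"
    then obtain p where [simp]: "x = c p"
      by auto
    show "x \<preceq>\<^bsub>lindenbaum c\<^esub> \<one>\<^bsub>lindenbaum c\<^esub>"
      by (simp add: entails_of_derives S'_derives.axiom S12)
    show "\<zero>\<^bsub>lindenbaum c\<^esub> \<preceq>\<^bsub>lindenbaum c\<^esub> x"
      by (simp add: entails_axiom S13)
    \<comment> \<open>S14 is one half; the other is the exchange of the reflexive implication from
      the negation of \<open>p\<close> to itself.\<close>
    show "neg (lindenbaum c) (neg (lindenbaum c) x) = x"
      by (simp add: neg_def naming_eq_iff equivalent_def entails_axiom S14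
          entails_exchange[OF entails_refl])
    \<comment> \<open>Reflexivity at the cube of \<open>p\<close>, curried twice, is an instance of
      the antecedent of S15.\<close>
    have "entails G p (p \<^bold>\<Rightarrow> p \<^bold>\<Rightarrow> (p \<^bold>* p) \<^bold>* p)"
      by (simp add: entails_refl entails_fusion_iff[symmetric])
    then have "entails G p (p \<^bold>\<Rightarrow> (p \<^bold>* p) \<^bold>* p)"
      using entails_impD[OF entails_axiom[OF S15]] by blast
    then show "x \<otimes>\<^bsub>lindenbaum c\<^esub> x \<preceq>\<^bsub>lindenbaum c\<^esub> x \<otimes>\<^bsub>lindenbaum c\<^esub> x \<otimes>\<^bsub>lindenbaum c\<^esub> x"
      by (simp add: entails_fusion_iff)
  next
    fix x y z
    assume "x \<in> carrier (lindenbaum c)" "y \<in> carrier (lindenbaum c)" "z \<in> carrier (lindenbaum c)"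
    then show "x \<otimes>\<^bsub>lindenbaum c\<^esub> y \<preceq>\<^bsub>lindenbaum c\<^esub> z \<longleftrightarrow> y \<preceq>\<^bsub>lindenbaum c\<^esub> x \<rightarrow>\<^bsub>lindenbaum c\<^esub> z"
      by (auto simp: entails_fusion_iff')
  qed auto
qed

lemma eval_lindenbaum: "eval (lindenbaum c) (\<lambda>n. c (Var n)) p = c p"
  by (induction p) simp_all

lemma naming_eq_one_iff: "c p = c \<^bold>1 \<longleftrightarrow> S'_derives G p"
  using entails_of_derives[OF S'_derives.axiom[OF S12]]
  by (simp add: naming_eq_iff equivalent_def derives_iff_entails_one)

end

section \<open>Naming the classes inside an infinite type\<close>

instance form :: (countable) countable
  by countable_datatype

lemma ex_class_naming:
  assumes "infinite (UNIV :: 'a set)"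
  shows "\<exists>c :: fm \<Rightarrow> 'a. class_naming G c"
proof -
  obtain f :: "nat \<Rightarrow> 'a" where "inj f"
    using infinite_countable_subset[OF assms] by auto
  \<comment> \<open>Choose a representative of the class of \<open>p\<close>, code it as a natural
    number, and inject that into \<open>'a\<close>.\<close>
  define c where "c p = f (to_nat (SOME q. equivalent G p q))" for p
  have "c p = c q \<longleftrightarrow> equivalent G p q" for p q
  proof
    assume "c p = c q"
    then have eq: "(SOME r. equivalent G p r) = (SOME r. equivalent G q r)"
      unfolding c_def using \<open>inj f\<close> by (simp add: inj_eq)
    have "equivalent G p (SOME r. equivalent G p r)" for p
      by (rule someI[of _ p]) (simp add: equivalent_def entails_refl)
    from this[of p] this[of q] show "equivalent G p q"
      unfolding eq by (metis entails_trans equivalent_def)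
  next
    assume "equivalent G p q"
    \<comment> \<open>Equality of the predicates themselves makes the two choices coincide.\<close>
    then have "equivalent G p = equivalent G q"
      by (auto simp: equivalent_def fun_eq_iff intro: entails_trans)
    then show "c p = c q"
      by (simp add: c_def)
  qed
  then show ?thesis
    by (auto simp: class_naming_def)
qed


section \<open>Algebraizability\<close>

lemma E_insts_one: "E_insts {(Var 0, \<^bold>1)} G = (\<lambda>p. (p, \<^bold>1)) ` G"
  by (auto simp: E_insts_def E_inst_def)

lemma E_inst_one: "E_inst {(Var 0, \<^bold>1)} p = {(p, \<^bold>1)}"
  by (simp add: E_inst_def)

text \<open>For completeness one algebra suffices: the Lindenbaum algebra of \<open>G\<close> under
  the canonical valuation satisfies the premises, so it forces \<open>p\<close> to have the value of
  a theorem.\<close>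

lemma S'_derives_iff_eq_consequence:
  assumes "infinite (UNIV :: 'a set)"
  shows "S'_derives G p \<longleftrightarrow>
    eq_consequence (S'_algebras :: 'a cibrl_algebra set) ((\<lambda>p. (p, \<^bold>1)) ` G) {(p, \<^bold>1)}"
proof
  assume "S'_derives G p"
  then show "eq_consequence (S'_algebras :: 'a cibrl_algebra set) ((\<lambda>p. (p, \<^bold>1)) ` G) {(p, \<^bold>1)}"
    by (auto simp: eq_consequence_def satisfies_def S'_algebras_def intro: S'_algebra.soundness)
next
  assume *: "eq_consequence (S'_algebras :: 'a cibrl_algebra set) ((\<lambda>p. (p, \<^bold>1)) ` G) {(p, \<^bold>1)}"
  obtain c :: "fm \<Rightarrow> 'a" where "class_naming G c"
    using ex_class_naming[OF assms] by blast
  then interpret class_naming G c .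
  have "\<forall>e\<in>(\<lambda>p. (p, \<^bold>1)) ` G. satisfies (lindenbaum c) (\<lambda>n. c (Var n)) e"
    by (auto simp: satisfies_def eval_lindenbaum naming_eq_one_iff S'_derives.premise)
  moreover have "range (\<lambda>n. c (Var n)) \<subseteq> carrier (lindenbaum c)"
    by auto
  moreover have "lindenbaum c \<in> S'_algebras"
    by (simp add: S'_algebras_def lindenbaum_S'_algebra)
  ultimately have "satisfies (lindenbaum c) (\<lambda>n. c (Var n)) (p, \<^bold>1)"
    using * unfolding eq_consequence_def by blast
  then have "c p = c \<^bold>1"
    by (simp add: satisfies_def eval_lindenbaum)
  then show "S'_derives G p"
    by (simp add: naming_eq_one_iff)
qed

theorem theorem4p2:
  assumes "infinite (UNIV :: 'a set)"
  shows "algebraizable S'_derives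
    {(Var 0, \<^bold>1)}
    {Var 0 \<^bold>\<Rightarrow> Var 1, Var 1 \<^bold>\<Rightarrow> Var 0}
    (S'_algebras :: 'a cibrl_algebra set)"
proof -
  \<comment> \<open>Read at the values of the two variables, the two directions give the two halves
    of the interderivability.\<close>
  have "x = y \<longleftrightarrow> x \<rightarrow>\<^bsub>A\<^esub> y = \<one>\<^bsub>A\<^esub> \<and> y \<rightarrow>\<^bsub>A\<^esub> x = \<one>\<^bsub>A\<^esub>"
    if "A \<in> S'_algebras" "x \<in> carrier A" "y \<in> carrier A" for A :: "'a cibrl_algebra" and x y
    using that by (intro S'_algebra.eq_iff_resids_eq_one) (simp_all add: S'_algebras_def)
  \<comment> \<open>The image form is what \<open>E_insts_one\<close> produces from the equivalence
    formulas.\<close>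
  then have
    "eq_consequence (S'_algebras :: 'a cibrl_algebra set) {(Var 0, Var 1)}
      ((\<lambda>p. (p, \<^bold>1)) ` {Var 0 \<^bold>\<Rightarrow> Var 1, Var 1 \<^bold>\<Rightarrow> Var 0})"
    "eq_consequence (S'_algebras :: 'a cibrl_algebra set)
      ((\<lambda>p. (p, \<^bold>1)) ` {Var 0 \<^bold>\<Rightarrow> Var 1, Var 1 \<^bold>\<Rightarrow> Var 0}) {(Var 0, Var 1)}"
    unfolding eq_consequence_def satisfies_def by (auto simp: image_subset_iff)
  then show ?thesis
    using deductive_system_S'_derives S'_derives_iff_eq_consequence[OF assms]
    unfolding algebraizable_def E_insts_one E_inst_one by simp
qed

end
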